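(* Let $u_0\in C^1(\mathbb R\setminus\{0\})$ satisfy $\sup_{x\in\mathbb R\setminus\{0\}}|x\,u_0'(x)|<+\infty$. Let $u(x,t)$ be the solution to the Cauchy problem $u_t=u_{xx}$ on $\mathbb R\times(0,+\infty)$, $u(x,0)=u_0(x)$ for $x\in\mathbb R$. Then $$\left|u(\sqrt t\,x,t)-\left(F(-x)\,u_0(-\sqrt t)+F(+x)\,u_0(+\sqrt t)\right)\right|\leq G(-x)\left(\sup_{y<0}|y\,u_0'(y)|\right)+G(+x)\left(\sup_{y>0}|y\,u_0'(y)|\right)$$ for all $(x,t)\in\mathbb R\times(0,+\infty)$, where $F(z):=\frac{1}{2\sqrt\pi}\int_{-\infty}^z e^{-\frac{y^2}{4}}\,dy$ and $G(z):=\frac{1}{2\sqrt\pi}\int_0^{+\infty}e^{-\frac{(z-y)^2}{4}}\,|\log y|\,dy$.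
   Context: The solution to the Cauchy problem of the heat equation with initial value $u_0$ is the one given by the heat kernel: $u(x,t)=\frac{1}{2\sqrt{\pi t}}\int_{-\infty}^{+\infty}e^{-\frac{(x-y)^2}{4t}}u_0(y)\,dy$ for $(x,t)\in\mathbb R\times(0,+\infty)$. The function $u_0$ is not assumed to be bounded, and no regularity at $0$ is assumed. *)

theory Defs
  imports "HOL-Analysis.Analysis"
begin

(* The value u0 0 is immaterial. If |x u0'(x)| is bounded, u0 grows at most
   logarithmically at 0 and at infinity, so the integral converges absolutely for t > 0. *)
definition heat_solution :: "(real \<Rightarrow> real) \<Rightarrow> real \<Rightarrow> real \<Rightarrow> real" where
  "heat_solution u0 x t =
     1 / (2 * sqrt (pi * t)) * (LBINT y. exp (- ((x - y)\<^sup>2 / (4 * t))) * u0 y)"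

definition F :: "real \<Rightarrow> real" where
  "F z = 1 / (2 * sqrt pi) * (LBINT y:{..z}. exp (- (y\<^sup>2 / 4)))"

definition G :: "real \<Rightarrow> real" where
  "G z = 1 / (2 * sqrt pi) * (LBINT y:{0<..}. exp (- ((z - y)\<^sup>2 / 4)) * \<bar>ln y\<bar>)"

end

theory Submission
  imports Defs "HOL-Probability.Distributions" "HOL-Real_Asymp.Real_Asymp"
begin

text \<open>
  In the similarity variable \<open>y = sqrt t * w\<close> the solution at \<open>sqrt t * x\<close> is a Gaussian average
  of \<open>u0 (sqrt t * w)\<close>. On each half line \<open>u0\<close> is Lipschitz in \<open>ln \<bar>y\<bar>\<close>, hence \<open>u0 (sqrt t * w)\<close>
  differs from \<open>u0 (\<plusminus> sqrt t)\<close> by at most a multiple of \<open>\<bar>ln \<bar>w\<bar>\<bar>\<close>; averaging this pointwise bound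
  over the half lines gives the \<open>F\<close> and \<open>G\<close> terms.
\<close>

text \<open>The kernel is a multiple of the Gaussian density with mean \<open>z\<close> and variance
  2, so its integrability and first absolute moment reduce to known facts about normal
  distributions.\<close>

lemma heat_kernel_eq_normal_density:
  "exp (- ((z - y)\<^sup>2 / 4)) = 2 * sqrt pi * normal_density z (sqrt 2) y"
  by (simp add: normal_density_def real_sqrt_mult power2_commute)

lemma integrable_heat_kernel: "integrable lborel (\<lambda>y::real. exp (- ((z - y)\<^sup>2 / 4)))"
  unfolding heat_kernel_eq_normal_density by simp

lemma integrable_heat_kernel_abs:
  "integrable lborel (\<lambda>y::real. exp (- ((z - y)\<^sup>2 / 4)) * \<bar>y - z\<bar>)"
proof -
  have "integrable lborel (\<lambda>y. 2 * sqrt pi * (normal_density z (sqrt 2) y * \<bar>y - z\<bar> ^ 1))"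
    by (intro integrable_mult_right integrable_normal_moment_abs) simp
  then show ?thesis
    unfolding heat_kernel_eq_normal_density by (simp add: mult.assoc)
qed

text \<open>The integrand is nonnegative and has the antiderivative \<open>y - y * ln y\<close>,
  with finite limits 0 and 1 at the two ends.\<close>

lemma set_integrable_ln_unit_interval: "set_integrable lborel {0<..<1} (\<lambda>y::real. - ln y)"
proof -
  have "set_integrable lborel (einterval (ereal 0) (ereal 1)) (\<lambda>y::real. - ln y)"
  proof (rule interval_integral_FTC_nonneg(1)[where F = "\<lambda>y. y - y * ln y" and A = 0 and B = 1])
    fix y :: real assume y: "ereal 0 < ereal y" "ereal y < ereal 1"
    show "((\<lambda>y. y - y * ln y) has_real_derivative - ln y) (at y)"
      using y by (auto intro!: derivative_eq_intros)
    show "isCont (\<lambda>y. - ln y) y" using y by (auto intro!: continuous_intros)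
  next
    show "(((\<lambda>y. y - y * ln y) \<circ> real_of_ereal) \<longlongrightarrow> 0) (at_right (ereal 0))"
      unfolding ereal_tendsto_simps by real_asymp
    show "(((\<lambda>y. y - y * ln y) \<circ> real_of_ereal) \<longlongrightarrow> 1) (at_left (ereal 1))"
      unfolding ereal_tendsto_simps by real_asymp
  qed (auto intro!: AE_I2)
  then show ?thesis by simp
qed

text \<open>Domination by \<open>?g\<close>: below 1 the kernel is at most 1 and the logarithm
  itself is integrable; from 1 on, \<open>ln y \<le> y - 1\<close> reduces the claim to the first
  moment of the Gaussian.\<close>

lemma set_integrable_heat_kernel_ln:
  "set_integrable lborel {0<..} (\<lambda>y::real. exp (- ((z - y)\<^sup>2 / 4)) * \<bar>ln y\<bar>)"
proof -
  let ?k = "\<lambda>y::real. exp (- ((z - y)\<^sup>2 / 4))"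
  let ?g = "\<lambda>y. (indicator {0<..<1} y * - ln y + ?k y * \<bar>y - z\<bar>) + \<bar>z\<bar> * ?k y :: real"
  have "integrable lborel ?g"
    using set_integrable_ln_unit_interval integrable_heat_kernel integrable_heat_kernel_abs
    by (intro Bochner_Integration.integrable_add integrable_mult_right)
      (simp_all add: set_integrable_def)
  then show ?thesis
    unfolding set_integrable_def
  proof (rule Bochner_Integration.integrable_bound)
    show "AE y in lborel. norm (indicator {0<..} y *\<^sub>R (?k y * \<bar>ln y\<bar>)) \<le> norm (?g y)"
    proof (rule AE_I2)
      fix y :: real
      consider "y \<le> 0" | "0 < y" "y < 1" | "1 \<le> y" by linarith
      then show "norm (indicator {0<..} y *\<^sub>R (?k y * \<bar>ln y\<bar>)) \<le> norm (?g y)"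
      proof cases
        case 2
        have "?k y * - ln y \<le> 1 * - ln y" using 2 by (intro mult_right_mono) auto
        moreover have "\<bar>?k y * ln y\<bar> = ?k y * - ln y" using 2 by (simp add: abs_mult)
        moreover have "0 \<le> ?k y * \<bar>y - z\<bar>" "0 \<le> \<bar>z\<bar> * ?k y" by auto
        ultimately have "\<bar>?k y * ln y\<bar> \<le> \<bar>(- ln y + ?k y * \<bar>y - z\<bar>) + \<bar>z\<bar> * ?k y\<bar>"
          by linarith
        then show ?thesis using 2 by simp
      next
        case 3
        have "\<bar>ln y\<bar> \<le> \<bar>y - z\<bar> + \<bar>z\<bar>" using 3 ln_le_minus_one[of y] by (simp add: abs_if)
        then have "?k y * \<bar>ln y\<bar> \<le> ?k y * (\<bar>y - z\<bar> + \<bar>z\<bar>)" by (intro mult_left_mono) auto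
        then show ?thesis using 3 by (simp add: algebra_simps)
      qed simp
    qed
  qed simp
qed

text \<open>Substitute \<open>y = z - w\<close>. The two indicators differ only at
  \<open>w = 0\<close>, a null set.\<close>

lemma F_eq_half_line_integral:
  "F z = 1 / (2 * sqrt pi) * (LBINT w:{0<..}. exp (- ((z - w)\<^sup>2 / 4)))"
proof -
  have "(LBINT y:{..z}. exp (- (y\<^sup>2 / 4))) = (LBINT w. indicator {..z} (z - w) *\<^sub>R exp (- ((z - w)\<^sup>2 / 4)))"
    unfolding set_lebesgue_integral_def
    using lborel_integral_real_affine[of "-1" "\<lambda>y. indicator {..z} y *\<^sub>R exp (- (y\<^sup>2 / 4))" z] by simp
  also have "\<dots> = (LBINT w. indicator {0<..} w *\<^sub>R exp (- ((z - w)\<^sup>2 / 4)))"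
  proof (rule integral_cong_AE)
    show "AE w in lborel. indicator {..z} (z - w) *\<^sub>R exp (- ((z - w)\<^sup>2 / 4)) =
        indicator {0<..} w *\<^sub>R exp (- ((z - w)\<^sup>2 / 4))"
      using AE_lborel_singleton[of 0] by eventually_elim (simp add: indicator_def)
  qed simp_all
  finally show ?thesis by (simp add: F_def set_lebesgue_integral_def)
qed

text \<open>The mean value theorem for \<open>v \<mapsto> u (exp v)\<close>, whose derivative is \<open>y * u' y\<close> at \<open>y = exp v\<close>.\<close>

lemma log_lipschitz:
  fixes u u' :: "real \<Rightarrow> real"
  assumes deriv: "\<And>y. 0 < y \<Longrightarrow> (u has_real_derivative u' y) (at y)"
    and bound: "\<And>y. 0 < y \<Longrightarrow> \<bar>y * u' y\<bar> \<le> M"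
    and pos: "0 < a" "0 < b"
  shows "\<bar>u a - u b\<bar> \<le> M * \<bar>ln a - ln b\<bar>"
proof -
  have "norm (u (exp (ln a)) - u (exp (ln b))) \<le> M * norm (ln a - ln b)"
  proof (rule field_differentiable_bound[where S = UNIV and f' = "\<lambda>v. u' (exp v) * exp v"])
    fix v :: real
    show "((\<lambda>v. u (exp v)) has_real_derivative u' (exp v) * exp v) (at v)"
      by (rule DERIV_chain2[OF deriv]) (auto intro!: derivative_eq_intros)
    show "norm (u' (exp v) * exp v) \<le> M"
      using bound[of "exp v"] by (simp add: mult.commute)
  qed auto
  with pos show ?thesis by simp
qed

text \<open>Write \<open>u (s * w)\<close> as \<open>u s\<close> plus a difference
  \<open>u (s * w) - u s\<close>. The constant integrates to \<open>F z * u s\<close>; the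
  difference is at most \<open>M * \<bar>ln w\<bar>\<close> and integrates to at most
  \<open>G z * M\<close>.\<close>

lemma half_line_estimate:
  fixes u u' :: "real \<Rightarrow> real"
  assumes deriv: "\<And>y. 0 < y \<Longrightarrow> (u has_real_derivative u' y) (at y)"
    and bound: "\<And>y. 0 < y \<Longrightarrow> \<bar>y * u' y\<bar> \<le> M"
    and s: "0 < s"
  shows "set_integrable lborel {0<..} (\<lambda>w. exp (- ((z - w)\<^sup>2 / 4)) * u (s * w))"
    and "\<bar>1 / (2 * sqrt pi) * (LBINT w:{0<..}. exp (- ((z - w)\<^sup>2 / 4)) * u (s * w)) - F z * u s\<bar>
      \<le> G z * M"
proof -
  let ?k = "\<lambda>y::real. exp (- ((z - y)\<^sup>2 / 4))"
  let ?d = "\<lambda>w. ?k w * (u (s * w) - u s)"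
  have cont: "continuous_on {0<..} (\<lambda>w. u (s * w))"
    using s by (intro continuous_at_imp_continuous_on ballI DERIV_isCont)
      (auto intro!: DERIV_chain2[OF deriv] derivative_eq_intros)
  have "continuous_on {0<..} ?d" by (intro continuous_intros cont) auto
  then have meas: "set_borel_measurable lborel {0<..} ?d"
    unfolding set_borel_measurable_def
    using borel_measurable_continuous_on_indicator[of "{0<..}" ?d] by simp
  have le: "\<bar>?d w\<bar> \<le> ?k w * \<bar>ln w\<bar> * M" if "0 < w" for w
  proof -
    \<comment> \<open>Comparing with the value at \<open>s\<close> makes the bound scale-free:
      \<open>ln (s * w) - ln s = ln w\<close>.\<close>
    have "\<bar>u (s * w) - u s\<bar> \<le> M * \<bar>ln w\<bar>"
      using log_lipschitz[OF deriv bound, of "s * w" s] s that by (simp add: ln_mult)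
    then show ?thesis by (simp add: abs_mult mult.commute mult.left_commute)
  qed
  have kln: "set_integrable lborel {0<..} (\<lambda>w. ?k w * \<bar>ln w\<bar> * M)"
    by (rule set_integrable_mult_left) (rule set_integrable_heat_kernel_ln)
  have d: "set_integrable lborel {0<..} ?d"
    by (rule set_integrable_bound[OF kln meas]) (use le in \<open>force intro!: AE_I2\<close>)
  have k: "set_integrable lborel {0<..} (\<lambda>w. ?k w * u s)"
    using integrable_mult_indicator[OF _ integrable_heat_kernel, of "{0<..}"]
    by (intro set_integrable_mult_left) (simp add: set_integrable_def)
  have split: "(\<lambda>w. ?k w * u (s * w)) = (\<lambda>w. ?d w + ?k w * u s)"
    by (simp add: algebra_simps)
  show "set_integrable lborel {0<..} (\<lambda>w. ?k w * u (s * w))"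
    unfolding split by (rule set_integral_add(1)[OF d k])
  have "(LBINT w:{0<..}. ?k w * u (s * w)) = (LBINT w:{0<..}. ?d w) + (LBINT w:{0<..}. ?k w) * u s"
    unfolding split set_integral_add(2)[OF d k] by simp
  then have "1 / (2 * sqrt pi) * (LBINT w:{0<..}. ?k w * u (s * w)) - F z * u s
      = 1 / (2 * sqrt pi) * (LBINT w:{0<..}. ?d w)"
    by (simp add: F_eq_half_line_integral add_divide_distrib)
  moreover have "\<bar>LBINT w:{0<..}. ?d w\<bar> \<le> (LBINT w:{0<..}. ?k w * \<bar>ln w\<bar> * M)"
    unfolding set_lebesgue_integral_def real_norm_def[symmetric]
    by (rule Bochner_Integration.integral_norm_bound_integral)
      (use d kln le in \<open>auto simp: set_integrable_def indicator_def\<close>)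
  ultimately show "\<bar>1 / (2 * sqrt pi) * (LBINT w:{0<..}. ?k w * u (s * w)) - F z * u s\<bar> \<le> G z * M"
    by (simp add: G_def abs_mult divide_right_mono)
qed

text \<open>Under \<open>y = sqrt t * w\<close> the Jacobian \<open>sqrt t\<close> cancels the
  \<open>sqrt t\<close> in the normalising factor.\<close>

lemma heat_solution_similarity:
  assumes "0 < t"
  shows "heat_solution u (sqrt t * x) t =
    1 / (2 * sqrt pi) * (LBINT w. exp (- ((x - w)\<^sup>2 / 4)) * u (sqrt t * w))"
proof -
  have scale: "(sqrt t * x - sqrt t * w)\<^sup>2 / (4 * t) = (x - w)\<^sup>2 / 4" for w
    using assms by (simp add: right_diff_distrib[symmetric] power_mult_distrib)
  have "(LBINT y. exp (- ((sqrt t * x - y)\<^sup>2 / (4 * t))) * u y)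
      = sqrt t * (LBINT w. exp (- ((x - w)\<^sup>2 / 4)) * u (sqrt t * w))"
    using assms lborel_integral_real_affine[of "sqrt t"
        "\<lambda>y. exp (- ((sqrt t * x - y)\<^sup>2 / (4 * t))) * u y" 0]
    unfolding add_0 scale by simp
  then show ?thesis
    using assms by (simp add: heat_solution_def real_sqrt_mult)
qed

text \<open>Both halves are written over the positive half line, so that one estimate there serves
  for \<open>u0\<close> and for its reflection.\<close>

lemma lborel_integral_reflect_split:
  fixes f :: "real \<Rightarrow> real"
  assumes "set_integrable lborel {0<..} f" "set_integrable lborel {0<..} (\<lambda>w. f (- w))"
  shows "(LBINT w. f w) = (LBINT w:{0<..}. f (- w)) + (LBINT w:{0<..}. f w)"
proof -
  let ?n = "\<lambda>w. indicator {0<..} (- w) *\<^sub>R f w" and ?p = "\<lambda>w. indicator {0<..} w *\<^sub>R f w"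
  have n: "integrable lborel ?n"
    using lborel_integrable_real_affine[OF assms(2)[unfolded set_integrable_def], of "-1" 0] by simp
  have p: "integrable lborel ?p" using assms(1) by (simp add: set_integrable_def)
  have sum: "AE w in lborel. ?n w + ?p w = f w"
    using AE_lborel_singleton[of 0] by eventually_elim (simp add: indicator_def)
  \<comment> \<open>Measurability of \<open>f\<close> follows from that of its two restrictions once
    the value at 0 is patched in.\<close>
  have "(\<lambda>w. if w = 0 then f 0 else ?n w + ?p w) \<in> borel_measurable lborel"
    using borel_measurable_integrable[OF n] borel_measurable_integrable[OF p] by measurable
  moreover have "(\<lambda>w. if w = 0 then f 0 else ?n w + ?p w) = f"
    by (auto simp: indicator_def fun_eq_iff)
  ultimately have "f \<in> borel_measurable lborel" by simp
  then have "(LBINT w. f w) = (LBINT w. ?n w + ?p w)"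
    using n p sum by (intro integral_cong_AE) (auto dest: borel_measurable_integrable)
  also have "\<dots> = (LBINT w. ?n w) + (LBINT w. ?p w)"
    by (rule Bochner_Integration.integral_add[OF n p])
  also have "(LBINT w. ?n w) = (LBINT w:{0<..}. f (- w))"
    unfolding set_lebesgue_integral_def
    using lborel_integral_real_affine[of "-1" ?n 0] by simp
  finally show ?thesis by (simp add: set_lebesgue_integral_def)
qed

theorem proposition6:
  fixes u0 :: "real \<Rightarrow> real" and x t :: real
  assumes "u0 C1_differentiable_on (- {0})"
    and "bdd_above ((\<lambda>y. \<bar>y * deriv u0 y\<bar>) ` (- {0}))"
    and "t > 0"
  shows "\<bar>heat_solution u0 (sqrt t * x) t - (F (- x) * u0 (- sqrt t) + F x * u0 (sqrt t))\<bar>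
    \<le> G (- x) * (SUP y\<in>{..<0}. \<bar>y * deriv u0 y\<bar>) + G x * (SUP y\<in>{0<..}. \<bar>y * deriv u0 y\<bar>)"
proof -
  let ?k = "\<lambda>z y::real. exp (- ((z - y)\<^sup>2 / 4))"
  obtain D where D: "\<And>y. y \<noteq> 0 \<Longrightarrow> (u0 has_real_derivative D y) (at y)"
    using assms(1)
    by (auto simp: C1_differentiable_on_def has_real_derivative_iff_has_vector_derivative)
  have deriv: "(u0 has_real_derivative deriv u0 y) (at y)" if "y \<noteq> 0" for y
    using D[OF that] DERIV_imp_deriv[OF D[OF that]] by simp
  have deriv_neg: "((\<lambda>y. u0 (- y)) has_real_derivative - deriv u0 (- y)) (at y)" if "0 < y" for y
  proof -
    have "((\<lambda>y. u0 (- y)) has_real_derivative deriv u0 (- y) * -1) (at y)"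
      by (rule DERIV_chain2[OF deriv]) (use that in \<open>auto intro!: derivative_eq_intros\<close>)
    then show ?thesis by simp
  qed
  have bound_pos: "\<bar>y * deriv u0 y\<bar> \<le> (SUP y\<in>{0<..}. \<bar>y * deriv u0 y\<bar>)" if "0 < y" for y
    using that by (intro cSUP_upper bdd_above_mono[OF assms(2)]) auto
  have "\<bar>y * deriv u0 y\<bar> \<le> (SUP y\<in>{..<0}. \<bar>y * deriv u0 y\<bar>)" if "y < 0" for y
    using that by (intro cSUP_upper bdd_above_mono[OF assms(2)]) auto
  \<comment> \<open>At \<open>- y\<close> the bound becomes the one for the reflected function,
    whose derivative is \<open>- deriv u0 (- y)\<close>.\<close>
  from this[of "- y" for y]
  have bound_neg: "\<bar>y * - deriv u0 (- y)\<bar> \<le> (SUP y\<in>{..<0}. \<bar>y * deriv u0 y\<bar>)" if "0 < y" for y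
    using that by simp
  have s: "0 < sqrt t" using assms(3) by simp
  note pos = half_line_estimate[OF deriv bound_pos s, of x, simplified]
  note neg = half_line_estimate[OF deriv_neg bound_neg s, of "- x", simplified]
  \<comment> \<open>Reflection moves the centre of the kernel from \<open>x\<close> to
    \<open>- x\<close>, hence the arguments \<open>- x\<close> of \<open>F\<close> and
    \<open>G\<close> in the terms from the negative half line.\<close>
  have reflect: "?k x (- w) = ?k (- x) w" for w
    by (simp add: power2_eq_square algebra_simps)
  have "(LBINT w. ?k x w * u0 (sqrt t * w)) =
      (LBINT w:{0<..}. ?k (- x) w * u0 (- (sqrt t * w))) + (LBINT w:{0<..}. ?k x w * u0 (sqrt t * w))"
    using lborel_integral_reflect_split[of "\<lambda>w. ?k x w * u0 (sqrt t * w)"] pos(1) neg(1)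
    unfolding reflect by simp
  then have "heat_solution u0 (sqrt t * x) t =
      (LBINT w:{0<..}. ?k (- x) w * u0 (- (sqrt t * w))) / (2 * sqrt pi)
      + (LBINT w:{0<..}. ?k x w * u0 (sqrt t * w)) / (2 * sqrt pi)"
    using heat_solution_similarity[OF assms(3), of u0 x] by (simp add: add_divide_distrib)
  \<comment> \<open>The triangle inequality adds the errors of the two half lines.\<close>
  with pos(2) neg(2) show ?thesis by linarith
qed

end
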